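(* Let $X$ be a Hausdorff topological vector space and let $f:X\to\mathbb{R}$ be a continuous map that is locally Lipschitzian at every point of $X$. Then: (i) For all $x,x'\in X$, $Lf(x,x')=\{A(x'):A\in\partial f(x)\}$. (ii) If for some $x\in X$ the interval $Lf(x,x')$ is a single point for all $x'\in X$, then $f$ has a Gateaux derivative at $x$, given by $Df(x,-)=Lf(x,-):X\to\mathbb{R}$. (iii) If $Lf(x,x')$ is a single point for all $x$ in an open set $O\subseteq X$ and all $x'\in X$, then the map $O\to X^*$, $x\mapsto Df(x,-)$, is continuous with respect to the weak* topology on $X^*$. (iv) If $X$ is a finite-dimensional Euclidean space and $Lf(x,x')$ is a single point for all $x$ in an open set $O\subseteq X$ and all $x'\in X$, then $f$ is differentiable in $O$ with $f'(x)=Df(x,-)$ for $x\in O$.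
   Context: $\mathbb{IR}$ denotes the domain of non-empty compact real intervals ordered by reverse inclusion, augmented with $\mathbb{R}$ itself as bottom element; a real number is identified with the singleton interval. For a continuous $f:X\to\mathbb{R}$ on a Hausdorff topological vector space $X$, the domain-theoretic directional derivative $Lf:X\times X\to\mathbb{IR}$ is $Lf(x,x')=\left[\liminf_{y\to x,\,z\to x',\,r\to 0^+}\frac{f(y+rz)-f(y)}{r},\ \limsup_{y\to x,\,z\to x',\,r\to 0^+}\frac{f(y+rz)-f(y)}{r}\right]$ if both endpoints are real numbers, and $Lf(x,x')=(-\infty,\infty)$ (bottom) otherwise. $f$ is locally Lipschitzian at $x$ if there exist an open neighbourhood $O$ of $x$, an open neighbourhood $O'$ of the origin and a compact interval $C$ with $Lf(y,y')\subseteq C$ for all $(y,y')\in O\times O'$. $X^*$ is the space of continuous linear functionals $X\to\mathbb{R}$ with the weak* topology (the weakest topology making $A\mapsto A(x)$ continuous for each $x\in X$). Put $f^\circ(x;x')=\limsup_{y\to x,\,t\to 0^+}\frac{f(y+tx')-f(y)}{t}$ and $\partial f(x)=\{A\in X^*:\forall x'\in X,\ A(x')\le f^\circ(x;x')\}$. $f$ has a Gateaux derivative at $x$ if there is $Df(x,-)\in X^*$ such that for every $x'$ the limit $\lim_{r\to0^+}\frac{f(x+rx')-f(x)}{r}$ exists and equals $Df(x,x')$. *)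

theory Defs
  imports "HOL-Analysis.Analysis"
begin

class hausdorff_tvs = topological_ab_group_add + real_vector + t2_space +
  assumes tendsto_scaleR_Pair:
    "filterlim (\<lambda>p. fst p *\<^sub>R snd p) (nhds (c *\<^sub>R x)) (nhds c \<times>\<^sub>F nhds x)"

instance real_normed_vector \<subseteq> hausdorff_tvs
proof
  fix c :: real and x :: 'a
  have "((\<lambda>p. fst p *\<^sub>R snd p) \<longlongrightarrow> c *\<^sub>R x) (nhds c \<times>\<^sub>F nhds x)"
    by (intro tendsto_scaleR filterlim_fst filterlim_snd)
  then show "filterlim (\<lambda>p. fst p *\<^sub>R snd p) (nhds (c *\<^sub>R x)) (nhds c \<times>\<^sub>F nhds x)" .
qed

text \<open>
  Elements of the interval domain are represented by the sets they denote; the bottom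
  element is \<^term>\<open>UNIV :: real set\<close> and a real number \<open>c\<close> is the singleton \<open>{c}\<close>.
  The information order is reverse inclusion.
\<close>

definition interval_domain :: "real set set" where
  "interval_domain = insert UNIV {{a..b} | a b. a \<le> b}"

text \<open>
  The filter \<open>nhds x\<close> does not exclude \<open>x\<close>, so \<open>y = x\<close> and \<open>z = x'\<close> are allowed in the
  limits; only \<open>r\<close> is restricted to positive values. The limits are taken in
  \<^typ>\<open>ereal\<close>, so that they always exist.
\<close>

definition lower_dd :: "('a::hausdorff_tvs \<Rightarrow> real) \<Rightarrow> 'a \<Rightarrow> 'a \<Rightarrow> ereal" where
  "lower_dd f x x' =
     Liminf (nhds x \<times>\<^sub>F nhds x' \<times>\<^sub>F at_right 0)
       (\<lambda>(y, z, r). ereal ((f (y + r *\<^sub>R z) - f y) / r))"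

definition upper_dd :: "('a::hausdorff_tvs \<Rightarrow> real) \<Rightarrow> 'a \<Rightarrow> 'a \<Rightarrow> ereal" where
  "upper_dd f x x' =
     Limsup (nhds x \<times>\<^sub>F nhds x' \<times>\<^sub>F at_right 0)
       (\<lambda>(y, z, r). ereal ((f (y + r *\<^sub>R z) - f y) / r))"

definition Lderiv :: "('a::hausdorff_tvs \<Rightarrow> real) \<Rightarrow> 'a \<Rightarrow> 'a \<Rightarrow> real set" where
  "Lderiv f x x' =
     (if \<bar>lower_dd f x x'\<bar> \<noteq> \<infinity> \<and> \<bar>upper_dd f x x'\<bar> \<noteq> \<infinity>
      then {real_of_ereal (lower_dd f x x') .. real_of_ereal (upper_dd f x x')}
      else UNIV)"

lemma lower_dd_le_upper_dd: "lower_dd f x x' \<le> upper_dd f x x'"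
  unfolding lower_dd_def upper_dd_def
  by (intro Liminf_le_Limsup) (simp add: prod_filter_eq_bot)

lemma Lderiv_in_interval_domain: "Lderiv f x x' \<in> interval_domain"
proof (cases "\<bar>lower_dd f x x'\<bar> \<noteq> \<infinity> \<and> \<bar>upper_dd f x x'\<bar> \<noteq> \<infinity>")
  case True
  then have "real_of_ereal (lower_dd f x x') \<le> real_of_ereal (upper_dd f x x')"
    using lower_dd_le_upper_dd[of f x x']
    by (cases "lower_dd f x x'"; cases "upper_dd f x x'") auto
  with True show ?thesis
    unfolding Lderiv_def interval_domain_def by auto
next
  case False
  then show ?thesis
    unfolding Lderiv_def interval_domain_def by auto
qed

definition locally_lipschitzian_at :: "('a::hausdorff_tvs \<Rightarrow> real) \<Rightarrow> 'a \<Rightarrow> bool" where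
  "locally_lipschitzian_at f x \<longleftrightarrow>
     (\<exists>U V a b. open U \<and> x \<in> U \<and> open V \<and> 0 \<in> V \<and> a \<le> b \<and>
        (\<forall>y\<in>U. \<forall>y'\<in>V. Lderiv f y y' \<subseteq> {a..b}))"

definition dual_space :: "('a::hausdorff_tvs \<Rightarrow> real) set" where
  "dual_space = {A. linear A \<and> continuous_on UNIV A}"

definition weak_star_topology :: "('a::hausdorff_tvs \<Rightarrow> real) topology" where
  "weak_star_topology =
     topology_generated_by {{A \<in> dual_space. A x \<in> S} | x S. open S}"

lemma topspace_weak_star_topology: "topspace weak_star_topology = dual_space"
  unfolding weak_star_topology_def topology_generated_by_topspace
  using open_UNIV by blast

definition clarke_dd :: "('a::hausdorff_tvs \<Rightarrow> real) \<Rightarrow> 'a \<Rightarrow> 'a \<Rightarrow> ereal" where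
  "clarke_dd f x x' =
     Limsup (nhds x \<times>\<^sub>F at_right 0) (\<lambda>(y, t). ereal ((f (y + t *\<^sub>R x') - f y) / t))"

definition generalized_gradient :: "('a::hausdorff_tvs \<Rightarrow> real) \<Rightarrow> 'a \<Rightarrow> ('a \<Rightarrow> real) set" where
  "generalized_gradient f x = {A \<in> dual_space. \<forall>x'. ereal (A x') \<le> clarke_dd f x x'}"

definition has_gateaux_derivative ::
    "('a::hausdorff_tvs \<Rightarrow> real) \<Rightarrow> ('a \<Rightarrow> real) \<Rightarrow> 'a \<Rightarrow> bool" where
  "has_gateaux_derivative f D x \<longleftrightarrow>
     D \<in> dual_space \<and>
     (\<forall>x'. ((\<lambda>r. (f (x + r *\<^sub>R x') - f x) / r) \<longlongrightarrow> D x') (at_right 0))"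

definition gateaux_derivative :: "('a::hausdorff_tvs \<Rightarrow> real) \<Rightarrow> 'a \<Rightarrow> 'a \<Rightarrow> real" where
  "gateaux_derivative f x = (THE D. has_gateaux_derivative f D x)"

lemma gateaux_derivative_eqI:
  assumes "has_gateaux_derivative f D x"
  shows "gateaux_derivative f x = D"
  unfolding gateaux_derivative_def
proof (rule the_equality)
  fix E assume E: "has_gateaux_derivative f E x"
  show "E = D"
  proof
    fix x'
    show "E x' = D x'"
    proof (rule tendsto_unique[OF trivial_limit_at_right_real])
      show "((\<lambda>r. (f (x + r *\<^sub>R x') - f x) / r) \<longlongrightarrow> E x') (at_right 0)"
        using E unfolding has_gateaux_derivative_def by blast
      show "((\<lambda>r. (f (x + r *\<^sub>R x') - f x) / r) \<longlongrightarrow> D x') (at_right 0)"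
        using assms unfolding has_gateaux_derivative_def by blast
    qed
  qed
qed (fact assms)

end

theory Submission
  imports Defs
begin

text \<open>
  Finiteness of \<open>p = upper_dd f x\<close> alone makes \<open>p\<close> sublinear with \<open>p 0 = 0\<close>, and the latter
  forces \<open>p = clarke_dd f x\<close>. As \<open>lower_dd f x z = - p (- z)\<close>, the interval \<open>Lderiv f x z\<close> is
  the set of values at \<open>z\<close> of the linear functionals below \<open>p\<close>, by the Hahn-Banach theorem;
  these functionals are continuous because \<open>p < 1\<close> near \<open>0\<close>. When all intervals are points, \<open>p\<close>
  is linear and the difference quotients converge to it along the full filter. Upper
  semicontinuity of \<^const>\<open>upper_dd\<close> then gives weak* continuity, and compactness of the unit
  sphere gives Frechet differentiability.
\<close>

section \<open>The Hahn-Banach theorem\<close>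

text \<open>Homogeneity is asked for as an inequality with \<open>c > 0\<close>. Applying it also to
  \<open>1 / c\<close> gives equality, and \<open>c = 2\<close> at the origin then gives
  \<open>p 0 = 0\<close>.\<close>

definition sublinear :: "('a::real_vector \<Rightarrow> real) \<Rightarrow> bool" where
  "sublinear p \<longleftrightarrow>
     (\<forall>x y. p (x + y) \<le> p x + p y) \<and> (\<forall>c>0. \<forall>x. p (c *\<^sub>R x) \<le> c * p x)"

lemma sublinear_add: "sublinear p \<Longrightarrow> p (x + y) \<le> p x + p y"
  by (simp add: sublinear_def)

lemma sublinear_scaleR:
  assumes "sublinear p" "0 < c"
  shows "p (c *\<^sub>R x) = c * p x"
proof (rule antisym)
  show "p (c *\<^sub>R x) \<le> c * p x"
    using assms by (simp add: sublinear_def)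
  have "p ((1 / c) *\<^sub>R c *\<^sub>R x) \<le> (1 / c) * p (c *\<^sub>R x)"
    using assms unfolding sublinear_def by (meson zero_less_divide_1_iff)
  then show "c * p x \<le> p (c *\<^sub>R x)"
    using assms(2) by (simp add: field_simps)
qed

lemma sublinear_zero: "sublinear p \<Longrightarrow> p 0 = 0"
  using sublinear_scaleR[of p 2 0] by simp

lemma sublinear_minus: "sublinear p \<Longrightarrow> - p (- x) \<le> p x"
  using sublinear_add[of p x "- x"] sublinear_zero[of p] by simp

text \<open>Subadditivity at \<open>- x\<close> and \<open>- y\<close> is, by oddness, the reverse
  inequality at \<open>x\<close> and \<open>y\<close>; oddness also carries homogeneity over to
  negative scalars.\<close>

lemma sublinear_odd_imp_linear:
  assumes p: "sublinear p" and odd: "\<And>x. p (- x) = - p x"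
  shows "linear p"
proof (rule linearI)
  show "p (x + y) = p x + p y" for x y
    using sublinear_add[OF p, of x y] sublinear_add[OF p, of "- x" "- y"] odd[of "x + y"] odd[of x]
      odd[of y]
    by simp
  show "p (c *\<^sub>R x) = c *\<^sub>R p x" for c x
  proof (cases c "0 :: real" rule: linorder_cases)
    case less
    then show ?thesis
      using sublinear_scaleR[OF p, of "- c" x] odd[of "c *\<^sub>R x"] by simp
  qed (use sublinear_scaleR[OF p] sublinear_zero[OF p] in auto)
qed

text \<open>
  The largest sublinear \<open>q \<le> p\<close> with \<open>q (- v) \<le> - p v\<close>, that is, with \<open>q\<close> linear on the line
  through \<open>v\<close> and \<open>q v = p v\<close>.
\<close>

definition ray_linearization :: "('a::real_vector \<Rightarrow> real) \<Rightarrow> 'a \<Rightarrow> 'a \<Rightarrow> real" where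
  "ray_linearization p v x = (INF t\<in>{0..}. p (x + t *\<^sub>R v) - t * p v)"

lemma ray_linearization_le:
  assumes p: "sublinear p" and "0 \<le> t"
  shows "ray_linearization p v x \<le> p (x + t *\<^sub>R v) - t * p v"
  unfolding ray_linearization_def
proof (rule cINF_lower)
  \<comment> \<open>The infimum is finite: \<open>s * p v = p (s *\<^sub>R v)\<close>, and the right
    side is at most \<open>p (x + s *\<^sub>R v) + p (- x)\<close>.\<close>
  have "- p (- x) \<le> p (x + s *\<^sub>R v) - s * p v" if "0 \<le> s" for s
  proof -
    have "p (s *\<^sub>R v) = s * p v"
      using that sublinear_scaleR[OF p] sublinear_zero[OF p] by (cases "s = 0") auto
    then show ?thesis
      using sublinear_add[OF p, of "x + s *\<^sub>R v" "- x"] by simp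
  qed
  then show "bdd_below ((\<lambda>t. p (x + t *\<^sub>R v) - t * p v) ` {0..})"
    by (intro bdd_belowI2[of _ "- p (- x)"]) auto
qed (use \<open>0 \<le> t\<close> in auto)

lemma ray_linearization_greatest:
  "(\<And>t. 0 \<le> t \<Longrightarrow> m \<le> p (x + t *\<^sub>R v) - t * p v) \<Longrightarrow> m \<le> ray_linearization p v x"
  unfolding ray_linearization_def by (intro cINF_greatest) auto

text \<open>Parameters \<open>s\<close> for \<open>x\<close> and \<open>t\<close> for
  \<open>y\<close> combine to \<open>s + t\<close> for \<open>x + y\<close>, and \<open>t\<close>
  for \<open>x\<close> becomes \<open>c * t\<close> for \<open>c *\<^sub>R x\<close>. The infima are
  then taken one variable at a time.\<close>

lemma sublinear_ray_linearization:
  assumes p: "sublinear p"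
  shows "sublinear (ray_linearization p v)"
  unfolding sublinear_def
proof (intro conjI allI impI)
  fix x y
  have "ray_linearization p v (x + y)
      \<le> (p (x + s *\<^sub>R v) - s * p v) + (p (y + t *\<^sub>R v) - t * p v)"
    if "0 \<le> s" "0 \<le> t" for s t
  proof -
    have "p (x + y + (s + t) *\<^sub>R v) \<le> p (x + s *\<^sub>R v) + p (y + t *\<^sub>R v)"
      using sublinear_add[OF p, of "x + s *\<^sub>R v" "y + t *\<^sub>R v"]
      by (simp add: algebra_simps)
    then show ?thesis
      using ray_linearization_le[OF p, of "s + t" v "x + y"] that
      by (simp add: algebra_simps)
  qed
  then have "ray_linearization p v (x + y) - (p (x + s *\<^sub>R v) - s * p v)
      \<le> ray_linearization p v y" if "0 \<le> s" for s
    using that by (intro ray_linearization_greatest) (smt (verit))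
  then have "ray_linearization p v (x + y) - ray_linearization p v y
      \<le> ray_linearization p v x"
    by (intro ray_linearization_greatest) (smt (verit))
  then show "ray_linearization p v (x + y) \<le> ray_linearization p v x + ray_linearization p v y"
    by simp
next
  fix c :: real and x
  assume c: "0 < c"
  have "ray_linearization p v (c *\<^sub>R x) / c \<le> ray_linearization p v x"
  proof (rule ray_linearization_greatest)
    fix t :: real assume t: "0 \<le> t"
    have "p (c *\<^sub>R x + (c * t) *\<^sub>R v) = c * p (x + t *\<^sub>R v)"
      using sublinear_scaleR[OF p c, of "x + t *\<^sub>R v"] by (simp add: scaleR_add_right)
    then have "ray_linearization p v (c *\<^sub>R x) \<le> c * (p (x + t *\<^sub>R v) - t * p v)"
      using ray_linearization_le[OF p, of "c * t" v "c *\<^sub>R x"] c t by (simp add: algebra_simps)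
    then show "ray_linearization p v (c *\<^sub>R x) / c \<le> p (x + t *\<^sub>R v) - t * p v"
      using c by (simp add: field_simps)
  qed
  then show "ray_linearization p v (c *\<^sub>R x) \<le> c * ray_linearization p v x"
    using c by (simp add: field_simps)
qed

lemma ray_linearization_le_self: "sublinear p \<Longrightarrow> ray_linearization p v x \<le> p x"
  using ray_linearization_le[of p 0 v x] by simp

lemma ray_linearization_minus: "sublinear p \<Longrightarrow> ray_linearization p v (- v) \<le> - p v"
  using ray_linearization_le[of p 1 v "- v"] sublinear_zero[of p] by simp

section \<open>Linear functionals dominated by a sublinear one\<close>

text \<open>Provides the lower bounds for Zorn's lemma. The values at \<open>x\<close> are bounded
  below by \<open>- p (- x)\<close>. For subadditivity, two members \<open>q\<close> and
  \<open>q'\<close> are compared, and the smaller one bounds the infimum at \<open>x + y\<close> by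
  \<open>q x + q' y\<close>.\<close>

lemma sublinear_INF_chain:
  assumes C: "C \<noteq> {}" "\<And>q. q \<in> C \<Longrightarrow> sublinear q" "\<And>q x. q \<in> C \<Longrightarrow> q x \<le> p x"
    and chain: "\<And>q q'. q \<in> C \<Longrightarrow> q' \<in> C \<Longrightarrow> q \<le> q' \<or> q' \<le> q"
  shows "sublinear (\<lambda>x. INF q\<in>C. q x)" and "\<And>q. q \<in> C \<Longrightarrow> (INF q\<in>C. q x) \<le> q x"
proof -
  have lower: "(INF q\<in>C. q x) \<le> q x" if "q \<in> C" for q x
  proof (rule cINF_lower[OF _ that])
    have "- p (- x) \<le> q x" if "q \<in> C" for q
      using sublinear_minus[OF C(2)[OF that], of x] C(3)[OF that, of "- x"] by linarith
    then show "bdd_below ((\<lambda>q. q x) ` C)"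
      by (intro bdd_belowI2[of _ "- p (- x)"]) auto
  qed
  then show "\<And>q. q \<in> C \<Longrightarrow> (INF q\<in>C. q x) \<le> q x" .
  show "sublinear (\<lambda>x. INF q\<in>C. q x)"
    unfolding sublinear_def
  proof (intro conjI allI impI)
    fix x y
    have "(INF q\<in>C. q (x + y)) \<le> q x + q' y" if q: "q \<in> C" "q' \<in> C" for q q'
      using chain[OF q]
    proof
      assume "q \<le> q'"
      then show ?thesis
        using lower[OF q(1), of "x + y"] sublinear_add[OF C(2)[OF q(1)], of x y] le_funD[of q q' y]
        by linarith
    next
      assume "q' \<le> q"
      then show ?thesis
        using lower[OF q(2), of "x + y"] sublinear_add[OF C(2)[OF q(2)], of x y] le_funD[of q' q x]
        by linarith
    qed
    then have "(INF q\<in>C. q (x + y)) - q x \<le> (INF q\<in>C. q y)" if "q \<in> C" for q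
      using that by (intro cINF_greatest C(1)) (smt (verit))
    then have "(INF q\<in>C. q (x + y)) - (INF q\<in>C. q y) \<le> (INF q\<in>C. q x)"
      by (intro cINF_greatest C(1)) (smt (verit))
    then show "(INF q\<in>C. q (x + y)) \<le> (INF q\<in>C. q x) + (INF q\<in>C. q y)"
      by simp
  next
    fix c :: real and x
    assume c: "0 < c"
    have "(INF q\<in>C. q (c *\<^sub>R x)) / c \<le> (INF q\<in>C. q x)"
    proof (intro cINF_greatest C(1))
      fix q assume q: "q \<in> C"
      show "(INF q\<in>C. q (c *\<^sub>R x)) / c \<le> q x"
        using lower[OF q, of "c *\<^sub>R x"] sublinear_scaleR[OF C(2)[OF q] c, of x] c
        by (simp add: field_simps)
    qed
    then show "(INF q\<in>C. q (c *\<^sub>R x)) \<le> c * (INF q\<in>C. q x)"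
      using c by (simp add: field_simps)
  qed
qed

text \<open>
  A minimal sublinear functional equals its own ray linearization in every direction,
  hence is odd.
\<close>

lemma linear_below_sublinear:
  assumes p: "sublinear p"
  obtains A where "linear A" "\<And>x. A x \<le> p x"
proof -
  define S where "S = {q. sublinear q \<and> q \<le> p}"
  \<comment> \<open>The order is reversed, so that Zorn's lemma yields a minimal sublinear
    functional.\<close>
  let ?P = "\<lambda>q q' :: 'a \<Rightarrow> real. q' \<le> q"
  have "\<exists>m\<in>S. \<forall>a\<in>S. ?P m a \<longrightarrow> a = m"
  proof (rule predicate_Zorn)
    show "partial_order_on S (relation_of ?P S)"
      by (rule partial_order_on_relation_ofI) auto
    fix C assume "C \<in> Chains (relation_of ?P S)"
    then have C: "C \<subseteq> S" "\<And>q q'. q \<in> C \<Longrightarrow> q' \<in> C \<Longrightarrow> q \<le> q' \<or> q' \<le> q"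
      by (auto simp: Chains_def relation_of_def)
    show "\<exists>u\<in>S. \<forall>a\<in>C. ?P a u"
    proof (cases "C = {}")
      case True
      then show ?thesis
        using p by (auto simp: S_def)
    next
      case False
      have *: "sublinear q" "q x \<le> p x" if "q \<in> C" for q x
        using that C(1) by (auto simp: S_def le_fun_def)
      have u: "sublinear (\<lambda>x. INF q\<in>C. q x)" and lower: "\<And>q x. q \<in> C \<Longrightarrow> (INF q\<in>C. q x) \<le> q x"
        using sublinear_INF_chain[of C p] False * C(2) by blast+
      from False obtain q where q: "q \<in> C"
        by blast
      have "(INF q\<in>C. q x) \<le> p x" for x
        using lower[OF q, of x] *(2)[OF q, of x] by linarith
      then show ?thesis
        using u lower by (intro bexI[of _ "\<lambda>x. INF q\<in>C. q x"]) (auto simp: S_def le_fun_def)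
    qed
  qed
  then obtain m where m: "sublinear m" "m \<le> p"
    and min: "\<And>q. sublinear q \<Longrightarrow> q \<le> p \<Longrightarrow> q \<le> m \<Longrightarrow> q = m"
    by (auto simp: S_def)
  have "m (- v) = - m v" for v
  proof (rule antisym)
    have le: "ray_linearization m v \<le> m"
      by (auto simp: le_fun_def ray_linearization_le_self[OF m(1)])
    have "ray_linearization m v = m"
      by (rule min[OF sublinear_ray_linearization[OF m(1)] order_trans[OF le m(2)] le])
    then show "m (- v) \<le> - m v"
      using ray_linearization_minus[OF m(1), of v] by simp
    show "- m v \<le> m (- v)"
      using sublinear_minus[OF m(1), of v] by simp
  qed
  then have "linear m"
    by (rule sublinear_odd_imp_linear[OF m(1)])
  with m(2) show ?thesis
    by (intro that[of m]) (auto simp: le_fun_def)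
qed

text \<open>A linear functional below the ray linearization satisfies
  \<open>A (- v) \<le> - p v\<close>, hence \<open>p v \<le> A v\<close>.\<close>

lemma linear_below_sublinear_touching:
  assumes p: "sublinear p"
  obtains A where "linear A" "\<And>x. A x \<le> p x" "A v = p v"
proof -
  obtain A where A: "linear A" "\<And>x. A x \<le> ray_linearization p v x"
    using linear_below_sublinear[OF sublinear_ray_linearization[OF p]] by metis
  have le: "A x \<le> p x" for x
    using A(2)[of x] ray_linearization_le_self[OF p, of v x] by linarith
  moreover have "A v = p v"
    using A(2)[of "- v"] ray_linearization_minus[OF p, of v] linear_neg[OF A(1), of v] le[of v]
    by linarith
  ultimately show ?thesis
    using that A(1) by blast
qed

text \<open>Functionals touching \<open>p\<close> at \<open>v\<close> and at \<open>- v\<close>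
  attain the two endpoints at \<open>v\<close>; a convex combination of them attains
  \<open>c\<close> and stays below \<open>p\<close>.\<close>

lemma linear_below_sublinear_through:
  assumes p: "sublinear p" and c: "- p (- v) \<le> c" "c \<le> p v"
  obtains A where "linear A" "\<And>x. A x \<le> p x" "A v = c"
proof -
  obtain A where A: "linear A" "\<And>x. A x \<le> p x" "A v = p v"
    using linear_below_sublinear_touching[OF p] by metis
  obtain B where B: "linear B" "\<And>x. B x \<le> p x" "B (- v) = p (- v)"
    using linear_below_sublinear_touching[OF p] by metis
  have Bv: "B v = - p (- v)"
    using B(3) linear_neg[OF B(1), of v] by simp
  obtain t where t: "0 \<le> t" "t \<le> 1" "c = (1 - t) * B v + t * A v"
    using c unfolding A(3) Bv
    by (metis closed_segment_eq_real_ivl in_segment(1) atLeastAtMost_iff order_trans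
        real_scaleR_def)
  let ?D = "\<lambda>x. (1 - t) * B x + t * A x"
  have "linear ?D"
    using A(1) B(1) by (intro linearI) (auto simp: linear_add linear_scale algebra_simps)
  moreover have "?D x \<le> p x" for x
    using convex_bound_le[OF B(2) A(2), of "1 - t" t x] t by simp
  ultimately show ?thesis
    using that t(3) by blast
qed

section \<open>Upper directional derivatives\<close>

lemma tvs_tendsto_scaleR:
  fixes g :: "'b \<Rightarrow> 'a::hausdorff_tvs"
  assumes "(c \<longlongrightarrow> c0) F" "(g \<longlongrightarrow> g0) F"
  shows "((\<lambda>x. c x *\<^sub>R g x) \<longlongrightarrow> c0 *\<^sub>R g0) F"
  using filterlim_compose[OF tendsto_scaleR_Pair filterlim_Pair[OF assms]] by simp

section \<open>Continuity of linear functionals\<close>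

text \<open>Scaling the argument turns a one-sided bound near the origin into an arbitrarily small
  two-sided one; linearity moves continuity from the origin to every point.\<close>

lemma continuous_on_linear_bounded_above:
  fixes A :: "'a::hausdorff_tvs \<Rightarrow> real"
  assumes A: "linear A" and b: "\<forall>\<^sub>F z in nhds 0. A z \<le> b"
  shows "continuous_on UNIV A"
proof -
  have lim0: "(A \<longlongrightarrow> 0) (nhds 0)"
  proof (rule tendstoI)
    fix e :: real assume e: "0 < e"
    \<comment> \<open>Chosen so that \<open>b < c * e\<close>; the bounds at
      \<open>c *\<^sub>R z\<close> and \<open>(- c) *\<^sub>R z\<close> then give
      \<open>c * \<bar>A z\<bar> \<le> b\<close>.\<close>
    define c where "c = (\<bar>b\<bar> + 1) / e"
    have c: "0 < c"
      using e by (simp add: c_def)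
    have "((\<lambda>z. k *\<^sub>R z) \<longlongrightarrow> k *\<^sub>R 0) (nhds (0::'a))" for k
      by (intro tvs_tendsto_scaleR tendsto_const) (simp add: filterlim_ident)
    then have "\<forall>\<^sub>F z in nhds 0. A (k *\<^sub>R z) \<le> b" for k
      using b filterlim_iff by fastforce
    from this[of c] this[of "- c"]
    show "\<forall>\<^sub>F z in nhds 0. dist (A z) 0 < e"
    proof eventually_elim
      case (elim z)
      then have "c * \<bar>A z\<bar> \<le> b"
        using c by (simp add: linear_scale[OF A] linear_neg[OF A] abs_if)
      also have "\<dots> < c * e"
        using e by (simp add: c_def)
      finally show ?case
        using c by simp
    qed
  qed
  have "(A \<longlongrightarrow> A x) (at x)" for x
  proof -
    have "((\<lambda>z. z - x) \<longlongrightarrow> 0) (at x)"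
      using tendsto_diff[OF tendsto_ident_at[of x UNIV] tendsto_const[of x]] by simp
    from filterlim_compose[OF lim0 this] have "((\<lambda>z. A x + A (z - x)) \<longlongrightarrow> A x + 0) (at x)"
      by (intro tendsto_add tendsto_const)
    then show ?thesis
      by (simp add: linear_diff[OF A])
  qed
  then show ?thesis
    by (simp add: continuous_on_def)
qed

section \<open>Substitutions in the limits of difference quotients\<close>

abbreviation dd_filter :: "'a::hausdorff_tvs \<Rightarrow> 'a \<Rightarrow> ('a \<times> 'a \<times> real) filter" where
  "dd_filter x z \<equiv> nhds x \<times>\<^sub>F nhds z \<times>\<^sub>F at_right 0"

definition diff_quot :: "('a::real_vector \<Rightarrow> real) \<Rightarrow> 'a \<times> 'a \<times> real \<Rightarrow> real" where
  "diff_quot f = (\<lambda>(y, z, r). (f (y + r *\<^sub>R z) - f y) / r)"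

lemma dd_filter_neq_bot: "dd_filter x z \<noteq> bot"
  by (simp add: prod_filter_eq_bot)

lemma upper_dd_eq: "upper_dd f x z = Limsup (dd_filter x z) (\<lambda>w. ereal (diff_quot f w))"
  by (simp add: upper_dd_def diff_quot_def case_prod_unfold)

lemma lower_dd_eq: "lower_dd f x z = Liminf (dd_filter x z) (\<lambda>w. ereal (diff_quot f w))"
  by (simp add: lower_dd_def diff_quot_def case_prod_unfold)

lemma dd_filter_tendsto:
  shows "(fst \<longlongrightarrow> x) (dd_filter x z)" "((\<lambda>w. fst (snd w)) \<longlongrightarrow> z) (dd_filter x z)"
    "filterlim (\<lambda>w. snd (snd w)) (at_right 0) (dd_filter x z)"
    "((\<lambda>w. snd (snd w)) \<longlongrightarrow> 0) (dd_filter x z)"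
proof -
  show "(fst \<longlongrightarrow> x) (dd_filter x z)"
    by (rule filterlim_fst)
  show "((\<lambda>w. fst (snd w)) \<longlongrightarrow> z) (dd_filter x z)"
    by (rule filterlim_compose[OF filterlim_fst filterlim_snd])
  show 3: "filterlim (\<lambda>w. snd (snd w)) (at_right 0) (dd_filter x z)"
    by (rule filterlim_compose[OF filterlim_snd filterlim_snd])
  then show "((\<lambda>w. snd (snd w)) \<longlongrightarrow> 0) (dd_filter x z)"
    by (rule filterlim_mono) (auto simp: at_within_le_nhds)
qed

lemma eventually_dd_filter_pos: "\<forall>\<^sub>F w in dd_filter x z. 0 < snd (snd w)"
  by (rule eventually_compose_filterlim[OF eventually_at_right_less dd_filter_tendsto(3)])

text \<open>The change-of-variables principle: each substitution that maps one filter into another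
  compares the corresponding upper limits.\<close>

lemma Limsup_filterlim_le:
  fixes X :: "_ \<Rightarrow> ereal"
  assumes "filterlim h G F"
  shows "Limsup F (\<lambda>w. X (h w)) \<le> Limsup G X"
  unfolding Limsup_le_iff
proof (intro allI impI)
  fix y assume "Limsup G X < y"
  then have "\<forall>\<^sub>F w in G. X w < y"
    by (rule Limsup_lessD)
  then show "\<forall>\<^sub>F w in F. X (h w) < y"
    by (rule eventually_compose_filterlim[OF _ assms])
qed

text \<open>Moving the base point by \<open>r\<close> times a convergent vector is harmless, since
  \<open>r\<close> tends to \<open>0\<close>.\<close>

lemma filterlim_dd_shift:
  fixes x z a :: "'a::hausdorff_tvs"
  assumes "((\<lambda>w. h w) \<longlongrightarrow> z') (dd_filter x z)"
    and "((\<lambda>w. k w) \<longlongrightarrow> k0) (dd_filter x z)"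
  shows "filterlim (\<lambda>w. (fst w + snd (snd w) *\<^sub>R k w, h w, snd (snd w)))
    (dd_filter x z') (dd_filter x z)"
proof (intro filterlim_Pair assms(1) dd_filter_tendsto(3))
  have "((\<lambda>w. fst w + snd (snd w) *\<^sub>R k w) \<longlongrightarrow> x + 0 *\<^sub>R k0) (dd_filter x z)"
    by (intro tendsto_add tvs_tendsto_scaleR dd_filter_tendsto assms(2))
  then show "((\<lambda>w. fst w + snd (snd w) *\<^sub>R k w) \<longlongrightarrow> x) (dd_filter x z)"
    by simp
qed

text \<open>
  The substitution \<open>(y, z, r) \<mapsto> (y + r z, - z, r)\<close> changes the sign of the
  difference quotient.
\<close>

lemma lower_dd_eq_uminus_upper_dd: "lower_dd f x z = - upper_dd f x (- z)"
proof -
  define h :: "'a \<times> 'a \<times> real \<Rightarrow> 'a \<times> 'a \<times> real"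
    where "h = (\<lambda>w. (fst w + snd (snd w) *\<^sub>R fst (snd w), - fst (snd w), snd (snd w)))"
  have lim: "filterlim h (dd_filter x (- z)) (dd_filter x z)" for z
    unfolding h_def by (rule filterlim_dd_shift[OF tendsto_minus]; rule dd_filter_tendsto(2))
  have h: "diff_quot f (h w) = - diff_quot f w" for w
    by (simp add: h_def diff_quot_def case_prod_unfold minus_divide_left)
  \<comment> \<open>The substitution maps each of the filters at \<open>z\<close> and
    \<open>- z\<close> into the other, which gives one inequality per direction.\<close>
  have "Limsup (dd_filter x z) (\<lambda>w. - ereal (diff_quot f w)) \<le> upper_dd f x (- z)"
    using Limsup_filterlim_le[OF lim[of z], of "\<lambda>w. ereal (diff_quot f w)"]
    by (simp add: h upper_dd_eq)
  moreover have "upper_dd f x (- z) \<le> Limsup (dd_filter x z) (\<lambda>w. - ereal (diff_quot f w))"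
    using Limsup_filterlim_le[OF lim[of "- z"], of "\<lambda>w. - ereal (diff_quot f w)"]
    by (simp add: h upper_dd_eq)
  ultimately have "upper_dd f x (- z) = - lower_dd f x z"
    unfolding lower_dd_eq by (metis antisym ereal_Limsup_uminus)
  then show ?thesis
    by simp
qed

text \<open>Replacing \<open>(z, r)\<close> by \<open>(z / c, c r)\<close> leaves the increment
  \<open>r z\<close> unchanged and divides the quotient by \<open>c\<close>.\<close>

lemma upper_dd_scaleR_le:
  assumes c: "0 < c"
  shows "upper_dd f x (c *\<^sub>R z) \<le> ereal c * upper_dd f x z"
proof -
  define h :: "'a \<times> 'a \<times> real \<Rightarrow> 'a \<times> 'a \<times> real"
    where "h = (\<lambda>w. (fst w, (1 / c) *\<^sub>R fst (snd w), c * snd (snd w)))"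
  have lim: "filterlim h (dd_filter x z) (dd_filter x (c *\<^sub>R z))"
    unfolding h_def
  proof (intro filterlim_Pair dd_filter_tendsto)
    have "((\<lambda>w. (1 / c) *\<^sub>R fst (snd w)) \<longlongrightarrow> (1 / c) *\<^sub>R c *\<^sub>R z) (dd_filter x (c *\<^sub>R z))"
      by (intro tvs_tendsto_scaleR dd_filter_tendsto tendsto_const)
    then show "((\<lambda>w. (1 / c) *\<^sub>R fst (snd w)) \<longlongrightarrow> z) (dd_filter x (c *\<^sub>R z))"
      using c by simp
    have "((\<lambda>w. c * snd (snd w)) \<longlongrightarrow> c * 0) (dd_filter x (c *\<^sub>R z))"
      by (intro tendsto_mult tendsto_const dd_filter_tendsto)
    then show "filterlim (\<lambda>w. c * snd (snd w)) (at_right 0) (dd_filter x (c *\<^sub>R z))"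
      unfolding filterlim_at using eventually_dd_filter_pos[of x "c *\<^sub>R z"] c
      by (auto elim!: eventually_mono)
  qed
  have h: "c * diff_quot f (h w) = diff_quot f w" for w
    using c by (simp add: h_def diff_quot_def case_prod_unfold)
  have "upper_dd f x (c *\<^sub>R z) = Limsup (dd_filter x (c *\<^sub>R z)) (\<lambda>w. ereal c * ereal (diff_quot f (h w)))"
    by (simp add: upper_dd_eq h)
  also have "\<dots> \<le> Limsup (dd_filter x z) (\<lambda>w. ereal c * ereal (diff_quot f w))"
    by (rule Limsup_filterlim_le[OF lim, of "\<lambda>w. ereal c * ereal (diff_quot f w)"])
  also have "\<dots> = ereal c * upper_dd f x z"
    unfolding upper_dd_eq using c by (intro Limsup_ereal_mult_left dd_filter_neq_bot) auto
  finally show ?thesis .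
qed

lemma Limsup_ereal_le_iff:
  "Limsup F (\<lambda>w. ereal (q w)) \<le> ereal c \<longleftrightarrow> (\<forall>e>0. \<forall>\<^sub>F w in F. q w < c + e)"
proof
  assume L: "Limsup F (\<lambda>w. ereal (q w)) \<le> ereal c"
  show "\<forall>e>0. \<forall>\<^sub>F w in F. q w < c + e"
  proof (intro allI impI)
    fix e :: real assume "0 < e"
    then have "Limsup F (\<lambda>w. ereal (q w)) < ereal (c + e)"
      by (intro le_less_trans[OF L]) simp
    from Limsup_lessD[OF this] show "\<forall>\<^sub>F w in F. q w < c + e"
      by simp
  qed
next
  assume R: "\<forall>e>0. \<forall>\<^sub>F w in F. q w < c + e"
  show "Limsup F (\<lambda>w. ereal (q w)) \<le> ereal c"
  proof (rule ereal_le_epsilon2)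
    fix e :: real assume "0 < e"
    with R have "\<forall>\<^sub>F w in F. q w < c + e"
      by blast
    then have "\<forall>\<^sub>F w in F. ereal (q w) \<le> ereal (c + e)"
      by eventually_elim simp
    then show "Limsup F (\<lambda>w. ereal (q w)) \<le> ereal c + ereal e"
      by (simp add: Limsup_bounded)
  qed
qed

text \<open>
  Splitting the increment \<open>r z\<close> as \<open>r z\<^sub>1 + r (z - z\<^sub>1)\<close> yields at the same time the
  subadditivity of \<^const>\<open>upper_dd\<close> and, for \<open>z\<^sub>2 = 0\<close>, its agreement with
  \<^const>\<open>clarke_dd\<close>.
\<close>

lemma upper_dd_add_le_clarke_dd:
  assumes a: "clarke_dd f x z1 \<le> ereal a" and b: "upper_dd f x z2 \<le> ereal b"
  shows "upper_dd f x (z1 + z2) \<le> ereal (a + b)"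
  unfolding upper_dd_eq Limsup_ereal_le_iff
proof (intro allI impI)
  let ?F = "dd_filter x (z1 + z2)"
  fix e :: real assume e: "0 < e"
  \<comment> \<open>The second increment starts at \<open>y + r z1\<close> in the direction
    \<open>z - z1\<close>, which tends to \<open>z2\<close>. The first keeps the fixed direction
    \<open>z1\<close>, so a bound on \<open>clarke_dd\<close> suffices for it.\<close>
  have "((\<lambda>w. fst (snd w) - z1) \<longlongrightarrow> z1 + z2 - z1) ?F"
    by (intro tendsto_diff dd_filter_tendsto tendsto_const)
  then have lim2: "filterlim (\<lambda>w. (fst w + snd (snd w) *\<^sub>R z1, fst (snd w) - z1, snd (snd w)))
      (dd_filter x z2) ?F"
    by (intro filterlim_dd_shift[OF _ tendsto_const]) simp
  have lim1: "filterlim (\<lambda>w. (fst w, snd (snd w))) (nhds x \<times>\<^sub>F at_right 0) ?F"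
    by (intro filterlim_Pair dd_filter_tendsto)
  have "\<forall>\<^sub>F w in dd_filter x z2. diff_quot f w < b + e / 2"
    using b e unfolding upper_dd_eq Limsup_ereal_le_iff by simp
  from eventually_compose_filterlim[OF this lim2] have "\<forall>\<^sub>F w in ?F. diff_quot f
      (fst w + snd (snd w) *\<^sub>R z1, fst (snd w) - z1, snd (snd w)) < b + e / 2" .
  moreover have "\<forall>\<^sub>F w in nhds x \<times>\<^sub>F at_right 0. diff_quot f (fst w, z1, snd w) < a + e / 2"
    using a e unfolding clarke_dd_def case_prod_unfold Limsup_ereal_le_iff
    by (simp add: diff_quot_def)
  from eventually_compose_filterlim[OF this lim1]
  have "\<forall>\<^sub>F w in ?F. diff_quot f (fst w, z1, snd (snd w)) < a + e / 2"
    by simp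
  ultimately show "\<forall>\<^sub>F w in ?F. diff_quot f w < a + b + e"
  proof eventually_elim
    case (elim w)
    have "diff_quot f w = diff_quot f (fst w + snd (snd w) *\<^sub>R z1, fst (snd w) - z1, snd (snd w))
        + diff_quot f (fst w, z1, snd (snd w))"
      by (simp add: diff_quot_def case_prod_unfold algebra_simps add_divide_distrib diff_divide_distrib)
    with elim show ?case
      by linarith
  qed
qed

lemma clarke_dd_le_upper_dd: "clarke_dd f x z \<le> upper_dd f x z"
proof -
  have "filterlim (\<lambda>w. (fst w, z, snd w)) (dd_filter x z) (nhds x \<times>\<^sub>F at_right 0)"
    by (intro filterlim_Pair filterlim_fst filterlim_snd tendsto_const)
  from Limsup_filterlim_le[OF this, of "\<lambda>w. ereal (diff_quot f w)"] show ?thesis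
    by (simp add: upper_dd_eq clarke_dd_def diff_quot_def case_prod_unfold)
qed

section \<open>Semicontinuity and finiteness of the upper derivative\<close>

text \<open>Joint upper semicontinuity: a bound on the quotients holds on a product of
  neighbourhoods, which remain neighbourhoods of all points \<open>u\<close> near \<open>x\<close>
  and \<open>v\<close> near \<open>z\<close>.\<close>

lemma eventually_upper_dd_le:
  assumes "upper_dd f x z < ereal c"
  shows "\<forall>\<^sub>F u in nhds x. \<forall>\<^sub>F v in nhds z. upper_dd f u v \<le> ereal c"
proof -
  have "\<forall>\<^sub>F w in dd_filter x z. ereal (diff_quot f w) < ereal c"
    using assms unfolding upper_dd_eq by (rule Limsup_lessD)
  then have "\<forall>\<^sub>F w in dd_filter x z. diff_quot f w \<le> c"
    by eventually_elim simp
  then obtain P Q where P: "eventually P (nhds x)"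
    and Q: "eventually Q (nhds z \<times>\<^sub>F at_right 0)"
    and PQ: "\<And>y w. P y \<Longrightarrow> Q w \<Longrightarrow> diff_quot f (y, w) \<le> c"
    unfolding eventually_prod_filter[of _ "nhds x"] by blast
  obtain R S where R: "eventually R (nhds z)" and S: "eventually S (at_right 0)"
    and RS: "\<And>v r. R v \<Longrightarrow> S r \<Longrightarrow> Q (v, r)"
    using Q unfolding eventually_prod_filter by blast
  have *: "upper_dd f u v \<le> ereal c"
    if "eventually P (nhds u)" "eventually R (nhds v)" for u v
  proof -
    have "eventually Q (nhds v \<times>\<^sub>F at_right 0)"
      unfolding eventually_prod_filter using that(2) S RS by blast
    with that(1) PQ have "\<forall>\<^sub>F w in dd_filter u v. diff_quot f w \<le> c"
      unfolding eventually_prod_filter[of _ "nhds u"] by blast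
    then show ?thesis
      unfolding upper_dd_eq by (intro Limsup_bounded) simp
  qed
  have "\<forall>\<^sub>F u in nhds x. eventually P (nhds u)" "\<forall>\<^sub>F v in nhds z. eventually R (nhds v)"
    using P R by (simp_all add: eventually_eventually)
  with * show ?thesis
    by (auto elim!: eventually_mono)
qed

text \<open>An infinite value would make the interval \<open>UNIV\<close>, which fits into no
  compact interval, so values are finite for directions in \<open>V\<close>. Every direction can be
  scaled into \<open>V\<close>, which excludes \<open>\<infinity>\<close> everywhere; the sign rule
  at \<open>- z\<close> then excludes \<open>- \<infinity>\<close>.\<close>

lemma locally_lipschitzian_at_imp_upper_dd_finite:
  assumes "locally_lipschitzian_at f x"
  shows "\<bar>upper_dd f x z\<bar> \<noteq> \<infinity>"
proof -
  obtain U V a b where UV: "x \<in> U" "open V" "0 \<in> V"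
    and L: "\<And>y y'. y \<in> U \<Longrightarrow> y' \<in> V \<Longrightarrow> Lderiv f y y' \<subseteq> {a..b}"
    using assms unfolding locally_lipschitzian_at_def by metis
  have fin: "\<bar>upper_dd f x v\<bar> \<noteq> \<infinity>" if "v \<in> V" for v
  proof
    assume "\<bar>upper_dd f x v\<bar> = \<infinity>"
    then have "Lderiv f x v = UNIV"
      by (auto simp: Lderiv_def)
    with L[OF UV(1) that] have "b + 1 \<in> {a..b}"
      by blast
    then show False
      by simp
  qed
  have less_top: "upper_dd f x z < \<infinity>" for z
  proof -
    have "((\<lambda>t. t *\<^sub>R z) \<longlongrightarrow> 0 *\<^sub>R z) (at_right (0::real))"
      by (intro tvs_tendsto_scaleR tendsto_const tendsto_ident_at)
    then have "\<forall>\<^sub>F t in at_right (0::real). t *\<^sub>R z \<in> V"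
      using UV(2,3) by (intro topological_tendstoD[of _ "0 *\<^sub>R z"]) auto
    then have "\<forall>\<^sub>F t in at_right (0::real). t *\<^sub>R z \<in> V \<and> 0 < t"
      by (intro eventually_conj eventually_at_right_less)
    then obtain t :: real where t: "t *\<^sub>R z \<in> V" "0 < t"
      using eventually_happens'[OF trivial_limit_at_right_real] by blast
    have "upper_dd f x z \<le> ereal (1 / t) * upper_dd f x (t *\<^sub>R z)"
      using upper_dd_scaleR_le[of "1 / t" f x "t *\<^sub>R z"] t(2) by simp
    also have "\<dots> < \<infinity>"
      using fin[OF t(1)] by (cases "upper_dd f x (t *\<^sub>R z)") auto
    finally show ?thesis .
  qed
  have "- upper_dd f x (- z) \<le> upper_dd f x z"
    using lower_dd_le_upper_dd[of f x z] by (simp add: lower_dd_eq_uminus_upper_dd)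
  with less_top[of z] less_top[of "- z"] show ?thesis
    by (cases "upper_dd f x z"; cases "upper_dd f x (- z)") auto
qed

section \<open>Locally Lipschitzian maps\<close>

text \<open>Infinite values are sent to \<open>0\<close>; they do not occur at points where
  \<open>f\<close> is locally Lipschitzian.\<close>

definition upper_dir :: "('a::hausdorff_tvs \<Rightarrow> real) \<Rightarrow> 'a \<Rightarrow> 'a \<Rightarrow> real" where
  "upper_dir f x z = real_of_ereal (upper_dd f x z)"

context
  fixes f :: "'a::hausdorff_tvs \<Rightarrow> real" and x :: 'a
  assumes lip: "locally_lipschitzian_at f x"
begin

lemma upper_dd_eq_upper_dir: "upper_dd f x z = ereal (upper_dir f x z)"
  using locally_lipschitzian_at_imp_upper_dd_finite[OF lip] by (simp add: upper_dir_def ereal_real')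

lemma sublinear_upper_dir: "sublinear (upper_dir f x)"
  unfolding sublinear_def
proof (intro conjI allI impI)
  show "upper_dir f x (z1 + z2) \<le> upper_dir f x z1 + upper_dir f x z2" for z1 z2
    using upper_dd_add_le_clarke_dd[of f x z1 "upper_dir f x z1" z2 "upper_dir f x z2"]
      clarke_dd_le_upper_dd[of f x z1]
    by (simp add: upper_dd_eq_upper_dir)
  show "upper_dir f x (c *\<^sub>R z) \<le> c * upper_dir f x z" if "0 < c" for c z
    using upper_dd_scaleR_le[OF that, of f x z] by (simp add: upper_dd_eq_upper_dir)
qed

lemma clarke_dd_eq_upper_dir: "clarke_dd f x z = ereal (upper_dir f x z)"
proof (rule antisym)
  show le: "clarke_dd f x z \<le> ereal (upper_dir f x z)"
    using clarke_dd_le_upper_dd[of f x z] by (simp add: upper_dd_eq_upper_dir)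
  show "ereal (upper_dir f x z) \<le> clarke_dd f x z"
  \<comment> \<open>Testing against real upper bounds \<open>a\<close> suffices. Splitting off the
    zero direction, where \<open>upper_dd\<close> vanishes, turns each of them into a bound on
    \<open>upper_dir\<close>.\<close>
  proof (rule ereal_le_real)
    fix a assume "clarke_dd f x z \<le> ereal a"
    from upper_dd_add_le_clarke_dd[OF this, of 0 0] show "ereal (upper_dir f x z) \<le> ereal a"
      by (simp add: upper_dd_eq_upper_dir sublinear_zero[OF sublinear_upper_dir])
  qed
qed

lemma Lderiv_eq_upper_dir: "Lderiv f x z = {- upper_dir f x (- z)..upper_dir f x z}"
  by (simp add: Lderiv_def lower_dd_eq_uminus_upper_dd upper_dd_eq_upper_dir)

text \<open>Continuity of \<open>A\<close> follows from domination: the upper derivative is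
  \<open>0\<close> in the zero direction, so semicontinuity keeps it at most \<open>1\<close> for
  directions near \<open>0\<close>.\<close>

lemma generalized_gradient_iff:
  "A \<in> generalized_gradient f x \<longleftrightarrow> linear A \<and> (\<forall>z. A z \<le> upper_dir f x z)"
proof -
  have "continuous_on UNIV A" if A: "linear A" "\<forall>z. A z \<le> upper_dir f x z"
  proof (rule continuous_on_linear_bounded_above[OF A(1)])
    have "\<forall>\<^sub>F u in nhds x. \<forall>\<^sub>F z in nhds 0. upper_dd f u z \<le> ereal 1"
      by (rule eventually_upper_dd_le)
        (simp add: upper_dd_eq_upper_dir sublinear_zero[OF sublinear_upper_dir])
    then have "\<forall>\<^sub>F z in nhds 0. upper_dd f x z \<le> ereal 1"
      by (rule eventually_nhds_x_imp_x)
    then show "\<forall>\<^sub>F z in nhds 0. A z \<le> 1"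
      by eventually_elim (use A(2) in \<open>auto simp: upper_dd_eq_upper_dir intro: order_trans\<close>)
  qed
  then show ?thesis
    by (auto simp: generalized_gradient_def dual_space_def clarke_dd_eq_upper_dir)
qed

text \<open>Hahn-Banach gives a functional through each point of the interval; conversely,
  domination at \<open>z\<close> and \<open>- z\<close> confines \<open>A z\<close> to the
  interval.\<close>

lemma Lderiv_eq_generalized_gradient: "Lderiv f x z = {A z | A. A \<in> generalized_gradient f x}"
proof (rule set_eqI, rule iffI)
  fix c assume "c \<in> Lderiv f x z"
  then have c: "- upper_dir f x (- z) \<le> c" "c \<le> upper_dir f x z"
    by (simp_all add: Lderiv_eq_upper_dir)
  obtain A where "linear A" "\<And>v. A v \<le> upper_dir f x v" "A z = c"
    using linear_below_sublinear_through[OF sublinear_upper_dir c] by metis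
  then show "c \<in> {A z | A. A \<in> generalized_gradient f x}"
    using generalized_gradient_iff by blast
next
  fix c assume "c \<in> {A z | A. A \<in> generalized_gradient f x}"
  then obtain A where A: "c = A z" "linear A" "\<And>v. A v \<le> upper_dir f x v"
    using generalized_gradient_iff by blast
  then show "c \<in> Lderiv f x z"
    using A(3)[of z] A(3)[of "- z"] linear_neg[OF A(2), of z] by (simp add: Lderiv_eq_upper_dir)
qed

section \<open>Points where all intervals are singletons\<close>

context
  assumes single: "\<And>z. is_singleton (Lderiv f x z)"
begin

lemma upper_dir_uminus: "upper_dir f x (- z) = - upper_dir f x z"
proof -
  obtain c where "{- upper_dir f x (- z)..upper_dir f x z} = {c}"
    using single[of z] unfolding Lderiv_eq_upper_dir by (rule is_singletonE)
  then show ?thesis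
    unfolding atLeastAtMost_singleton_iff by linarith
qed

lemma linear_upper_dir: "linear (upper_dir f x)"
  by (rule sublinear_odd_imp_linear[OF sublinear_upper_dir upper_dir_uminus])

text \<open>Being linear and dominated by itself, \<open>upper_dir f x\<close> is a member of the
  generalized gradient.\<close>

lemma upper_dir_in_dual_space: "upper_dir f x \<in> dual_space"
  using generalized_gradient_iff[of "upper_dir f x"] linear_upper_dir
  by (auto simp: generalized_gradient_def)

text \<open>Lower and upper limits coincide. Fixing \<open>y = x\<close> in this joint limit leads
  to both the Gateaux and the Frechet derivative.\<close>

lemma tendsto_diff_quot: "(diff_quot f \<longlongrightarrow> upper_dir f x z) (dd_filter x z)"
proof -
  have "((\<lambda>w. ereal (diff_quot f w)) \<longlongrightarrow> ereal (upper_dir f x z)) (dd_filter x z)"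
  proof (rule Liminf_eq_Limsup[OF dd_filter_neq_bot])
    show "Limsup (dd_filter x z) (\<lambda>w. ereal (diff_quot f w)) = ereal (upper_dir f x z)"
      unfolding upper_dd_eq[symmetric] by (rule upper_dd_eq_upper_dir)
    show "Liminf (dd_filter x z) (\<lambda>w. ereal (diff_quot f w)) = ereal (upper_dir f x z)"
      unfolding lower_dd_eq[symmetric] lower_dd_eq_uminus_upper_dd
      by (simp add: upper_dd_eq_upper_dir upper_dir_uminus)
  qed
  then show ?thesis
    by simp
qed

lemma has_gateaux_derivative_upper_dir: "has_gateaux_derivative f (upper_dir f x) x"
  unfolding has_gateaux_derivative_def
proof (intro conjI allI upper_dir_in_dual_space)
  fix z
  have "filterlim (\<lambda>r. (x, z, r)) (dd_filter x z) (at_right 0)"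
    by (intro filterlim_Pair tendsto_const filterlim_ident)
  from filterlim_compose[OF tendsto_diff_quot this]
  show "((\<lambda>r. (f (x + r *\<^sub>R z) - f x) / r) \<longlongrightarrow> upper_dir f x z) (at_right 0)"
    by (simp add: diff_quot_def)
qed

lemma gateaux_derivative_eq_upper_dir: "gateaux_derivative f x = upper_dir f x"
  by (rule gateaux_derivative_eqI[OF has_gateaux_derivative_upper_dir])

lemma Lderiv_eq_gateaux_derivative: "Lderiv f x z = {gateaux_derivative f x z}"
  by (simp add: Lderiv_eq_upper_dir upper_dir_uminus gateaux_derivative_eq_upper_dir)

end

end

section \<open>Weak* continuity of the derivative\<close>

lemma eventually_upper_dir_less:
  assumes lip: "\<And>x. locally_lipschitzian_at f x" and less: "upper_dir f x z < c"
  shows "\<forall>\<^sub>F u in nhds x. upper_dir f u z < c"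
proof -
  \<comment> \<open>The intermediate \<open>d\<close> restores strictness, because semicontinuity
    returns only a weak inequality.\<close>
  obtain d where d: "upper_dir f x z < d" "d < c"
    using dense[OF less] by blast
  have "\<forall>\<^sub>F u in nhds x. \<forall>\<^sub>F v in nhds z. upper_dd f u v \<le> ereal d"
    using d(1) by (intro eventually_upper_dd_le) (simp add: upper_dd_eq_upper_dir[OF lip])
  then show ?thesis
  proof eventually_elim
    case (elim u)
    then have "upper_dd f u z \<le> ereal d"
      by (rule eventually_nhds_x_imp_x)
    with d(2) show ?case
      by (simp add: upper_dd_eq_upper_dir[OF lip])
  qed
qed

text \<open>By oddness, upper semicontinuity in the direction \<open>- z\<close> is lower
  semicontinuity in the direction \<open>z\<close>.\<close>

lemma continuous_on_upper_dir:
  assumes lip: "\<And>x. locally_lipschitzian_at f x" and S: "open S"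
    and single: "\<And>x z. x \<in> S \<Longrightarrow> is_singleton (Lderiv f x z)"
  shows "continuous_on S (\<lambda>x. upper_dir f x z)"
  unfolding continuous_on_def
proof (intro ballI order_tendstoI)
  fix x c assume x: "x \<in> S"
  note at_le = filter_leD[OF at_within_le_nhds]
  show "\<forall>\<^sub>F u in at x within S. upper_dir f u z < c" if "upper_dir f x z < c"
    using eventually_upper_dir_less[OF lip that] by (rule at_le)
  show "\<forall>\<^sub>F u in at x within S. c < upper_dir f u z" if "c < upper_dir f x z"
  proof (rule at_le)
    have "\<forall>\<^sub>F u in nhds x. upper_dir f u (- z) < - c"
      using that by (intro eventually_upper_dir_less[OF lip])
        (simp add: upper_dir_uminus[OF lip single[OF x]])
    moreover have "\<forall>\<^sub>F u in nhds x. u \<in> S"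
      by (rule eventually_nhds_in_open[OF S x])
    ultimately show "\<forall>\<^sub>F u in nhds x. c < upper_dir f u z"
      by eventually_elim (simp add: upper_dir_uminus[OF lip single])
  qed
qed

text \<open>Preimages of subbasic sets are preimages under the evaluations
  \<open>\<lambda>x. D x z\<close>.\<close>

lemma continuous_map_weak_star:
  assumes "\<And>x. x \<in> S \<Longrightarrow> D x \<in> dual_space" and "\<And>z. continuous_on S (\<lambda>x. D x z)"
  shows "continuous_map (top_of_set S) weak_star_topology D"
  unfolding weak_star_topology_def
proof (rule continuous_on_generated_topo)
  fix U :: "('b \<Rightarrow> real) set"
  assume "U \<in> {{A \<in> dual_space. A z \<in> T} | z T. open T}"
  then obtain z T where U: "U = {A \<in> dual_space. A z \<in> T}" "open T"
    by blast
  have "D -` U \<inter> topspace (top_of_set S) = S \<inter> (\<lambda>x. D x z) -` T"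
    using assms(1) U(1) by auto
  then show "openin (top_of_set S) (D -` U \<inter> topspace (top_of_set S))"
    using continuous_openin_preimage_gen[OF assms(2) U(2)] by simp
next
  have "D x \<in> {A \<in> dual_space. A 0 \<in> UNIV}" if "x \<in> S" for x
    using assms(1)[OF that] by simp
  then show "D ` topspace (top_of_set S) \<subseteq> \<Union> {{A \<in> dual_space. A z \<in> T} | z T. open T}"
    using open_UNIV by (simp only: topspace_euclidean_subtopology) blast
qed

section \<open>Frechet differentiability in finite dimension\<close>

text \<open>The joint limit makes convergence of the quotients uniform near each direction
  \<open>z0\<close>; compactness of the unit sphere makes it uniform over all unit
  directions.\<close>

lemma has_derivative_gateaux_derivative:
  fixes g :: "'b::euclidean_space \<Rightarrow> real"
  assumes lip: "locally_lipschitzian_at g x" and single: "\<And>z. is_singleton (Lderiv g x z)"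
  shows "(g has_derivative gateaux_derivative g x) (at x)"
proof -
  let ?D = "upper_dir g x"
  note lin = linear_upper_dir[OF lip single]
  have cont: "continuous_on UNIV ?D"
    using upper_dir_in_dual_space[OF lip single] by (simp add: dual_space_def)
  have "\<exists>d>0. \<forall>h. 0 < norm h \<and> norm h < d \<longrightarrow> \<bar>g (x + h) - g x - ?D h\<bar> / norm h < e"
    if e: "0 < e" for e
  proof -
    let ?P = "\<lambda>z r. \<bar>diff_quot g (x, z, r) - ?D z\<bar> < e"
    have "\<forall>\<^sub>F (z, r) in nhds z0 \<times>\<^sub>F at_right 0. ?P z r" for z0
    proof -
      have "filterlim (\<lambda>w. (x, w)) (dd_filter x z0) (nhds z0 \<times>\<^sub>F at_right 0)"
        by (intro filterlim_Pair tendsto_const filterlim_ident)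
      from filterlim_compose[OF tendsto_diff_quot[OF lip single] this]
      have 1: "((\<lambda>w. diff_quot g (x, w)) \<longlongrightarrow> ?D z0) (nhds z0 \<times>\<^sub>F at_right 0)" .
      \<comment> \<open>Continuity of \<open>?D\<close> allows the error to be measured against
        \<open>?D z\<close> instead of \<open>?D z0\<close>.\<close>
      have "filterlim ?D (nhds (?D z0)) (nhds z0)"
        using cont by (simp add: continuous_on_eq_continuous_at isCont_def tendsto_at_iff_tendsto_nhds)
      from filterlim_compose[OF this filterlim_fst]
      have "((\<lambda>w. diff_quot g (x, w) - ?D (fst w)) \<longlongrightarrow> ?D z0 - ?D z0) (nhds z0 \<times>\<^sub>F at_right 0)"
        by (intro tendsto_diff 1)
      from tendstoD[OF this e] show ?thesis
        by (simp add: dist_real_def case_prod_unfold)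
    qed
    then have "\<exists>V d. open V \<and> z0 \<in> V \<and> 0 < d \<and> (\<forall>z\<in>V. \<forall>r. 0 < r \<and> r < d \<longrightarrow> ?P z r)" for z0
      unfolding eventually_prod_filter eventually_nhds eventually_at_right_field
      by (simp, metis)
    then obtain V d where V: "\<And>z0. open (V z0)" "\<And>z0. z0 \<in> V z0"
      and d: "\<And>z0. 0 < d z0"
      and P: "\<And>z0 z r. z \<in> V z0 \<Longrightarrow> 0 < r \<Longrightarrow> r < d z0 \<Longrightarrow> ?P z r"
      by metis
    have "sphere 0 1 \<subseteq> (\<Union>z0. V z0)"
      using V(2) by blast
    then obtain T where T: "finite T" "sphere 0 1 \<subseteq> (\<Union>z0\<in>T. V z0)"
      by (rule compactE_image[OF compact_sphere V(1)])
    \<comment> \<open>Inserting \<open>1\<close> keeps the minimum over a nonempty set whatever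
      \<open>T\<close> is.\<close>
    define m where "m = Min (insert 1 (d ` T))"
    have m: "0 < m" "\<And>z0. z0 \<in> T \<Longrightarrow> m \<le> d z0"
      using T(1) d by (auto simp: m_def)
    have "\<bar>g (x + h) - g x - ?D h\<bar> / norm h < e" if h: "0 < norm h" "norm h < m" for h
    proof -
      define z where "z = h /\<^sub>R norm h"
      have hz: "h = norm h *\<^sub>R z" and "z \<in> sphere 0 1"
        using h(1) by (auto simp: z_def)
      with T(2) obtain z0 where "z0 \<in> T" "z \<in> V z0"
        by blast
      then have "\<bar>diff_quot g (x, z, norm h) - ?D z\<bar> < e"
        using h m(2)[of z0] by (intro P[of z z0]) auto
      moreover have "?D h = norm h * ?D z"
        by (subst hz) (simp add: linear_scale[OF lin])
      ultimately show ?thesis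
        using h(1) by (simp add: diff_quot_def flip: hz) (simp add: field_simps abs_divide)
    qed
    with m(1) show ?thesis
      by blast
  qed
  then have "(g has_derivative ?D) (at x)"
    unfolding has_derivative_at LIM_def
    using lin by (auto simp: linear_linear dist_norm)
  then show ?thesis
    by (simp add: gateaux_derivative_eq_upper_dir[OF lip single])
qed

theorem theorem1:
  fixes f :: "'a::hausdorff_tvs \<Rightarrow> real"
    and g :: "'b::euclidean_space \<Rightarrow> real"
  shows
    "(continuous_on UNIV f \<and> (\<forall>x. locally_lipschitzian_at f x) \<longrightarrow>
        (\<forall>x x'. Lderiv f x x' = {A x' | A. A \<in> generalized_gradient f x}) \<and>
        (\<forall>x. (\<forall>x'. is_singleton (Lderiv f x x')) \<longrightarrow>
           (\<exists>D. has_gateaux_derivative f D x) \<and>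
           (\<forall>x'. {gateaux_derivative f x x'} = Lderiv f x x')) \<and>
        (\<forall>S. open S \<and> (\<forall>x\<in>S. \<forall>x'. is_singleton (Lderiv f x x')) \<longrightarrow>
           continuous_map (top_of_set S) weak_star_topology (\<lambda>x. gateaux_derivative f x))) \<and>
     (continuous_on UNIV g \<and> (\<forall>x. locally_lipschitzian_at g x) \<longrightarrow>
        (\<forall>S. open S \<and> (\<forall>x\<in>S. \<forall>x'. is_singleton (Lderiv g x x')) \<longrightarrow>
           (\<forall>x\<in>S. (g has_derivative gateaux_derivative g x) (at x))))"
proof (intro conjI impI allI ballI; (elim conjE)?)
  fix x x'
  assume lip: "\<forall>x. locally_lipschitzian_at f x"
  show "Lderiv f x x' = {A x' | A. A \<in> generalized_gradient f x}"
    using lip by (intro Lderiv_eq_generalized_gradient) simp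
next
  fix x
  assume lip: "\<forall>x. locally_lipschitzian_at f x" and single: "\<forall>x'. is_singleton (Lderiv f x x')"
  show "\<exists>D. has_gateaux_derivative f D x"
    using has_gateaux_derivative_upper_dir[of f x] lip single by blast
  show "{gateaux_derivative f x x'} = Lderiv f x x'" for x'
    using Lderiv_eq_gateaux_derivative[of f x x'] lip single by simp
next
  fix S
  assume lip: "\<forall>x. locally_lipschitzian_at f x" and S: "open S"
    and single: "\<forall>x\<in>S. \<forall>x'. is_singleton (Lderiv f x x')"
  have eq: "gateaux_derivative f x = upper_dir f x" if "x \<in> S" for x
    using lip single that by (intro gateaux_derivative_eq_upper_dir) auto
  show "continuous_map (top_of_set S) weak_star_topology (\<lambda>x. gateaux_derivative f x)"
  proof (rule continuous_map_weak_star)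
    show "gateaux_derivative f x \<in> dual_space" if "x \<in> S" for x
      using upper_dir_in_dual_space[of f x] lip single that by (simp add: eq)
    show "continuous_on S (\<lambda>x. gateaux_derivative f x z)" for z
      using continuous_on_upper_dir[of f S z] lip single S by (simp add: eq)
  qed
next
  fix S x
  assume "\<forall>x. locally_lipschitzian_at g x" "x \<in> S"
    and "\<forall>x\<in>S. \<forall>x'. is_singleton (Lderiv g x x')"
  then show "(g has_derivative gateaux_derivative g x) (at x)"
    by (intro has_derivative_gateaux_derivative) auto
qed

end
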